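(* Let $m,n\ge 1$ be integers. Then the following statements hold for the Thue chromatic number $\pi$ and the Thue choice number $\pi_{ch}$: 1. $\pi(K_n)=\pi_{ch}(K_n)=n$ for the complete graph $K_n$ on $n$ vertices. 2. $\pi(S_n)=\pi_{ch}(S_n)=2$ for the star $S_n$ on $n+1$ vertices. 3. $\pi(K_{m,n})=\pi_{ch}(K_{m,n})=\min\{m,n\}+1$ for the complete bipartite graph $K_{m,n}$.
   Context: A repetition is a sequence $r_1\ldots r_{2n}$ with $n\ge 1$ and $r_i=r_{n+i}$ for all $1\le i\le n$. A vertex colouring $\varphi$ of a simple graph $G$ is non-repetitive if for every $n\ge 1$ and every simple path (distinct vertices, consecutive ones adjacent) $v_1\ldots v_{2n}$ in $G$, the colour sequence $\varphi(v_1)\ldots\varphi(v_{2n})$ is not a repetition (the case $n=1$ says that $\varphi$ is a proper colouring). The Thue chromatic number $\pi(G)$ is the minimum number of colours in a non-repetitive colouring of $G$. The Thue choice number $\pi_{ch}(G)$ is the smallest integer $k$ such that for every list assignment $L:V(G)\to 2^{\mathbb{N}}$ with $|L(v)|\ge k$ for all $v$, there is a non-repetitive colouring $\varphi$ of $G$ with $\varphi(v)\in L(v)$ for all $v\in V(G)$. The star $S_n$ consists of one centre vertex adjacent to $n$ pairwise non-adjacent leaves, i.e. $S_n=K_{1,n}$. *)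

theory Defs
  imports "Graph_Theory.Graph_Theory"
begin

text \<open>
  Simple graphs are the finite, loop-free, symmetric digraphs without parallel arcs of the locale
  \<^locale>\<open>graph\<close>; \<open>vpath p G\<close> is a nonempty list of distinct vertices in
  which consecutive ones are adjacent.  The predicates \<open>complete_digraph n G\<close> and
  \<open>complete_bipartite_digraph m n G\<close> (which both include \<open>graph G\<close>) say that
  \<open>G\<close> is a copy of the respective graph, on an arbitrary vertex type.
\<close>

definition repetition :: "'c list \<Rightarrow> bool" where
  "repetition r \<longleftrightarrow> (\<exists>n\<ge>1. length r = 2 * n \<and> (\<forall>i<n. r ! i = r ! (n + i)))"

definition nonrepetitive :: "('a, 'b) pre_digraph \<Rightarrow> ('a \<Rightarrow> 'c) \<Rightarrow> bool" where
  "nonrepetitive G \<phi> \<longleftrightarrow> (\<forall>p. vpath p G \<longrightarrow> \<not> repetition (map \<phi> p))"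

text \<open>
  For a finite graph the sets minimised over below are nonempty, so that \<open>LEAST\<close> denotes a
  genuine minimum.  Colours are natural numbers without loss of generality.
\<close>

definition thue_chromatic_number :: "('a, 'b) pre_digraph \<Rightarrow> nat" where
  "thue_chromatic_number G = (LEAST k. \<exists>\<phi> :: 'a \<Rightarrow> nat.
     nonrepetitive G \<phi> \<and> finite (\<phi> ` verts G) \<and> card (\<phi> ` verts G) = k)"

text \<open>
  Lists may be infinite; since \<^const>\<open>card\<close> of an infinite set is \<open>0\<close>, the condition that a
  list has at least \<open>k\<close> elements needs a separate disjunct for that case.
\<close>

definition thue_choosable :: "('a, 'b) pre_digraph \<Rightarrow> nat \<Rightarrow> bool" where
  "thue_choosable G k \<longleftrightarrow> (\<forall>L :: 'a \<Rightarrow> nat set.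
     (\<forall>v\<in>verts G. infinite (L v) \<or> k \<le> card (L v)) \<longrightarrow>
     (\<exists>\<phi>. nonrepetitive G \<phi> \<and> (\<forall>v\<in>verts G. \<phi> v \<in> L v)))"

definition thue_choice_number :: "('a, 'b) pre_digraph \<Rightarrow> nat" where
  "thue_choice_number G = (LEAST k. thue_choosable G k)"

definition star_graph :: "nat \<Rightarrow> ('a, 'b) pre_digraph \<Rightarrow> bool" where
  "star_graph n G \<longleftrightarrow> graph G \<and> (\<exists>c A. verts G = insert c A \<and> c \<notin> A \<and> finite A \<and> card A = n \<and>
     arcs_ends G = {c} \<times> A \<union> A \<times> {c})"

lemma star_graph_iff_complete_bipartite:
  "star_graph n G \<longleftrightarrow> complete_bipartite_digraph 1 n G"
proof
  assume "star_graph n G"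
  then obtain c A where g: "graph G" and h: "verts G = insert c A" "c \<notin> A" "card A = n"
      "arcs_ends G = {c} \<times> A \<union> A \<times> {c}"
    unfolding star_graph_def by blast
  have "verts G = {c} \<union> A" "{c} \<inter> A = {}" "card {c} = 1"
    using h by auto
  then show "complete_bipartite_digraph 1 n G"
    unfolding complete_bipartite_digraph_def using g h by blast
next
  assume "complete_bipartite_digraph 1 n G"
  then obtain U V where g: "graph G" and h: "verts G = U \<union> V" "U \<inter> V = {}" "card U = 1"
      "card V = n" "arcs_ends G = U \<times> V \<union> V \<times> U"
    unfolding complete_bipartite_digraph_def by blast
  from g interpret graph G .
  from h(3) obtain c where c: "U = {c}" by (auto simp: card_1_singleton_iff)
  have "finite V" using finite_verts h(1) by simp
  then show "star_graph n G"
    unfolding star_graph_def using g h c by (intro conjI exI[of _ c] exI[of _ V]) auto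
qed

end

theory Submission
  imports Defs
begin

text \<open>
  The upper bounds rest on vertex covers.  If the vertices of a cover \<open>U\<close> get pairwise distinct
  colours that do not occur outside \<open>U\<close>, then a vertex of \<open>U\<close> cannot lie on a repetitively
  coloured path, because its partner in the other half would be the same vertex, while every path
  with at least two vertices meets \<open>U\<close>.  Such a colouring is chosen greedily from lists of size
  \<open>card U + 1\<close>.  Conversely, in a complete bipartite graph a colour repeated on both
  sides gives a path of four vertices coloured \<open>abab\<close>, so one side is coloured injectively, and the
  other side needs a further colour.
\<close>

lemma exists_in_list_avoiding:
  assumes "infinite A \<or> k \<le> card A" "finite B" "card B < k"
  shows "\<exists>a\<in>A. a \<notin> B"
proof (rule ccontr)
  assume "\<not> ?thesis"
  then have "A \<subseteq> B" by blast
  then have "finite A" "card A \<le> card B"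
    using assms(2) by (auto intro: finite_subset card_mono)
  then show False using assms by auto
qed

text \<open>Greedy choice: when a vertex is reached, the colours already used are fewer than the
  elements of its list, so a fresh one remains. No Hall-type condition is needed, since every list
  is as large as the whole set.\<close>

lemma inj_choice_from_lists:
  assumes "finite U" "\<And>u. u \<in> U \<Longrightarrow> infinite (L u) \<or> card U \<le> card (L u)"
  shows "\<exists>f. inj_on f U \<and> (\<forall>u\<in>U. f u \<in> L u)"
  using assms
proof (induction U rule: finite_induct)
  case empty
  then show ?case by simp
next
  case (insert x U)
  have "\<And>u. u \<in> U \<Longrightarrow> infinite (L u) \<or> card U \<le> card (L u)"
    using insert.prems insert.hyps by fastforce
  then obtain f where f: "inj_on f U" "\<forall>u\<in>U. f u \<in> L u"
    using insert.IH by blast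
  have "card (f ` U) < card (insert x U)"
    using insert.hyps card_image_le[of U f] by simp
  then obtain a where a: "a \<in> L x" "a \<notin> f ` U"
    using exists_in_list_avoiding[of "L x" "card (insert x U)" "f ` U"] insert.prems insert.hyps
    by auto
  have "inj_on (f(x := a)) (insert x U)"
    using f(1) a(2) insert.hyps(2) by (auto simp: inj_on_def)
  moreover have "\<forall>u\<in>insert x U. (f(x := a)) u \<in> L u"
    using f(2) a(1) by auto
  ultimately show ?case by blast
qed

lemma nonrepetitive_vertex_cover:
  assumes cover: "\<And>u v. (u, v) \<in> arcs_ends G \<Longrightarrow> u \<in> U \<or> v \<in> U"
    and inj: "inj_on \<phi> U"
    and sep: "\<And>u v. u \<in> U \<Longrightarrow> v \<in> verts G - U \<Longrightarrow> \<phi> u \<noteq> \<phi> v"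
  shows "nonrepetitive G \<phi>"
  unfolding nonrepetitive_def
proof (intro allI impI notI)
  fix p
  assume p: "vpath p G" and "repetition (map \<phi> p)"
  then obtain k where k: "k \<ge> 1" "length p = 2 * k"
    and rep: "\<And>i. i < k \<Longrightarrow> \<phi> (p ! i) = \<phi> (p ! (k + i))"
    unfolding repetition_def by auto
  have dist: "distinct p" and in_verts: "set p \<subseteq> verts G"
    and arcs: "set (vwalk_arcs p) \<subseteq> arcs_ends G"
    using p by (auto simp: vpath_def vwalk_def)
  \<comment> \<open>The colour of a vertex of \<open>U\<close> identifies it among all vertices:
    \<open>sep\<close> excludes partners outside \<open>U\<close>, and \<open>inj\<close> excludes
    other partners inside.\<close>
  have eq: "u = v" if "\<phi> u = \<phi> v" "u \<in> U" "v \<in> verts G" for u v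
    using that inj sep[of u v] by (auto simp: inj_on_def)
  have halves: "p ! i \<notin> U \<and> p ! (k + i) \<notin> U" if "i < k" for i
  proof -
    have "p ! i \<in> verts G" "p ! (k + i) \<in> verts G"
      using that k in_verts by (auto simp: subset_iff)
    moreover have "p ! i \<noteq> p ! (k + i)"
      using dist that k by (simp add: nth_eq_iff_index_eq)
    \<comment> \<open>\<open>eq\<close> applies in both directions, so neither of the two distinct,
      equally coloured vertices can be in \<open>U\<close>.\<close>
    ultimately show ?thesis
      using eq rep[OF that] by metis
  qed
  have disj: "v \<notin> U" if v: "v \<in> set p" for v
  proof -
    obtain j where j: "j < 2 * k" "v = p ! j"
      using v k(2) by (metis in_set_conv_nth)
    show ?thesis
    proof (cases "j < k")
      case True
      then show ?thesis using halves j by blast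
    next
      case False
      then show ?thesis using halves[of "j - k"] j by auto
    qed
  qed
  \<comment> \<open>As \<open>k \<ge> 1\<close>, the path has a first arc, and the cover must
    contain one of its ends.\<close>
  obtain x y q where "p = x # y # q"
    using k by (cases p; cases "tl p") auto
  then show False
    using arcs cover[of x y] disj by auto
qed

text \<open>The injective colouring of \<open>U\<close> uses at most \<open>card U\<close> colours,
  so the one extra list element lets every other vertex avoid them all. Vertices outside
  \<open>U\<close> may share colours freely.\<close>

lemma thue_choosable_vertex_cover:
  assumes "finite U" "U \<subseteq> verts G"
    and cover: "\<And>u v. (u, v) \<in> arcs_ends G \<Longrightarrow> u \<in> U \<or> v \<in> U"
  shows "thue_choosable G (card U + 1)"
  unfolding thue_choosable_def
proof (intro allI impI)
  fix L :: "'a \<Rightarrow> nat set"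
  assume L: "\<forall>v\<in>verts G. infinite (L v) \<or> card U + 1 \<le> card (L v)"
  have "\<And>u. u \<in> U \<Longrightarrow> infinite (L u) \<or> card U \<le> card (L u)"
    using L assms(2) by fastforce
  then obtain f where f: "inj_on f U" "\<forall>u\<in>U. f u \<in> L u"
    using inj_choice_from_lists[OF assms(1)] by blast
  have "\<exists>a\<in>L v. a \<notin> f ` U" if "v \<in> verts G" for v
    using exists_in_list_avoiding[of "L v" "card U + 1" "f ` U"] L that assms(1)
      card_image_le[of U f] by auto
  then obtain g where g: "\<And>v. v \<in> verts G \<Longrightarrow> g v \<in> L v \<and> g v \<notin> f ` U"
    by metis
  define \<phi> where "\<phi> v = (if v \<in> U then f v else g v)" for v
  have "nonrepetitive G \<phi>"
  proof (rule nonrepetitive_vertex_cover[OF cover])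
    show "inj_on \<phi> U"
      using f(1) by (simp add: \<phi>_def inj_on_def)
    show "\<phi> u \<noteq> \<phi> v" if "u \<in> U" "v \<in> verts G - U" for u v
    proof -
      have "f u \<noteq> g v"
        using that g[of v] by (metis DiffD1 imageI)
      then show ?thesis
        using that by (simp add: \<phi>_def)
    qed
  qed
  moreover have "\<forall>v\<in>verts G. \<phi> v \<in> L v"
    using f(2) g by (simp add: \<phi>_def)
  ultimately show "\<exists>\<phi>. nonrepetitive G \<phi> \<and> (\<forall>v\<in>verts G. \<phi> v \<in> L v)"
    by blast
qed

text \<open>Ordinary colouring is the case of the constant list \<open>{..<k}\<close>; this gives
  that the chromatic number is at most the choice number.\<close>

lemma thue_choosable_imp_colouring:
  assumes "thue_choosable G k"
  obtains \<phi> :: "'a \<Rightarrow> nat"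
  where "nonrepetitive G \<phi>" "finite (\<phi> ` verts G)" "card (\<phi> ` verts G) \<le> k"
proof -
  have "\<forall>v\<in>verts G. infinite {..<k} \<or> k \<le> card {..<k}"
    by simp
  then obtain \<phi> where \<phi>: "nonrepetitive G \<phi>" "\<forall>v\<in>verts G. \<phi> v \<in> {..<k}"
    using assms[unfolded thue_choosable_def, THEN spec, of "\<lambda>_. {..<k}"] by blast
  then have "\<phi> ` verts G \<subseteq> {..<k}" by blast
  then have "finite (\<phi> ` verts G)" "card (\<phi> ` verts G) \<le> k"
    using finite_subset card_mono[of "{..<k}"] by auto
  with \<phi>(1) show ?thesis by (rule that)
qed

text \<open>Since the choice number dominates the chromatic number, it is enough to bound the former
  from above and the latter from below.\<close>

lemma thue_numbers_eqI:
  fixes G :: "('a, 'b) pre_digraph"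
  assumes choosable: "thue_choosable G k"
    and lower: "\<And>\<phi> :: 'a \<Rightarrow> nat. nonrepetitive G \<phi> \<Longrightarrow> finite (\<phi> ` verts G) \<Longrightarrow>
      k \<le> card (\<phi> ` verts G)"
  shows "thue_chromatic_number G = k" "thue_choice_number G = k"
proof -
  obtain \<phi> :: "'a \<Rightarrow> nat"
    where \<phi>: "nonrepetitive G \<phi>" "finite (\<phi> ` verts G)" "card (\<phi> ` verts G) \<le> k"
    using thue_choosable_imp_colouring[OF choosable] .
  \<comment> \<open>The definition asks for a colouring with exactly \<open>k\<close> colours, while
    choosability yields only at most \<open>k\<close>; the lower bound closes the gap.\<close>
  then have "card (\<phi> ` verts G) = k"
    using lower by (simp add: le_antisym)
  then show "thue_chromatic_number G = k"
    unfolding thue_chromatic_number_def using \<phi> lower by (intro Least_equality) auto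
  show "thue_choice_number G = k"
    unfolding thue_choice_number_def
  proof (rule Least_equality)
    show "thue_choosable G k" by (rule choosable)
  next
    fix j
    assume "thue_choosable G j"
    then obtain \<psi> :: "'a \<Rightarrow> nat"
      where "nonrepetitive G \<psi>" "finite (\<psi> ` verts G)" "card (\<psi> ` verts G) \<le> j"
      by (rule thue_choosable_imp_colouring)
    then show "k \<le> j" using lower order_trans by blast
  qed
qed

text \<open>Properness is the repetition of half-length 1, read along the path
  \<open>[u, v]\<close>.\<close>

lemma nonrepetitive_arc_colours:
  assumes "nonrepetitive G \<phi>" "(u, v) \<in> arcs_ends G" "u \<in> verts G" "v \<in> verts G" "u \<noteq> v"
  shows "\<phi> u \<noteq> \<phi> v"
proof
  assume "\<phi> u = \<phi> v"
  then have "repetition (map \<phi> [u, v])"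
    unfolding repetition_def by (intro exI[of _ 1]) auto
  moreover have "vpath [u, v] G"
    using assms by (auto simp: vpath_def vwalk_def)
  ultimately show False
    using assms(1) unfolding nonrepetitive_def by blast
qed

lemma nonrepetitive_bipartite_inj:
  assumes "nonrepetitive G \<phi>" "U \<union> V \<subseteq> verts G" "U \<inter> V = {}"
    and arcs: "U \<times> V \<union> V \<times> U \<subseteq> arcs_ends G"
  shows "inj_on \<phi> U \<or> inj_on \<phi> V"
proof (rule ccontr)
  assume "\<not> ?thesis"
  then obtain u u' v v' where h: "u \<in> U" "u' \<in> U" "u \<noteq> u'" "\<phi> u = \<phi> u'"
      "v \<in> V" "v' \<in> V" "v \<noteq> v'" "\<phi> v = \<phi> v'"
    by (auto simp: inj_on_def)
  then have "repetition (map \<phi> [u, v, u', v'])"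
    unfolding repetition_def by (intro exI[of _ 2]) (auto simp: less_2_cases_iff)
  \<comment> \<open>The path alternates between the sides, so all its arcs exist, and disjointness
    of the sides keeps its four vertices distinct.\<close>
  moreover have "vpath [u, v, u', v'] G"
    using assms h by (auto simp: vpath_def vwalk_def)
  ultimately show False
    using assms(1) unfolding nonrepetitive_def by blast
qed

text \<open>Counting step of the bipartite lower bound: \<open>A\<close> is the injectively coloured
  side, and the nonempty side \<open>B\<close> contributes at least one new colour.\<close>

lemma card_image_disjoint_ge:
  assumes "finite (f ` (A \<union> B))" "inj_on f A" "B \<noteq> {}" "f ` A \<inter> f ` B = {}"
  shows "card A + 1 \<le> card (f ` (A \<union> B))"
proof -
  have "finite (f ` A)" "finite (f ` B)"
    using assms(1) by (simp_all add: image_Un)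
  then have "card (f ` (A \<union> B)) = card (f ` A) + card (f ` B)" "card (f ` B) > 0"
    using assms by (simp_all add: image_Un card_Un_disjoint card_gt_0_iff)
  then show ?thesis
    using assms(2) by (simp add: card_image)
qed

lemma thue_numbers_complete:
  fixes G :: "('a, 'b) pre_digraph"
  assumes "complete_digraph n G" "n \<ge> 1"
  shows "thue_chromatic_number G = n" "thue_choice_number G = n"
proof -
  have card: "card (verts G) = n"
    and arcs: "arcs_ends G = {(u, v). (u, v) \<in> verts G \<times> verts G \<and> u \<noteq> v}"
    using assms(1) by (auto simp: complete_digraph_def)
  have fin: "finite (verts G)"
    using card assms(2) by (auto intro: card_ge_0_finite)
  obtain w where w: "w \<in> verts G"
    using card assms(2) by fastforce
  \<comment> \<open>All vertices but one form a cover, because no arc has both ends equal to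
    \<open>w\<close>; its size is \<open>n - 1\<close>.\<close>
  have "thue_choosable G (card (verts G - {w}) + 1)"
    by (rule thue_choosable_vertex_cover) (use fin arcs in auto)
  then have choosable: "thue_choosable G n"
    using w fin card assms(2) by simp
  have lower: "n \<le> card (\<phi> ` verts G)" if "nonrepetitive G \<phi>" for \<phi> :: "'a \<Rightarrow> nat"
  proof -
    \<comment> \<open>Any two vertices are adjacent, so properness alone forces distinct
      colours.\<close>
    have "inj_on \<phi> (verts G)"
      using nonrepetitive_arc_colours[OF that] arcs by (auto simp: inj_on_def)
    then show ?thesis
      using card by (simp add: card_image)
  qed
  show "thue_chromatic_number G = n" "thue_choice_number G = n"
    using thue_numbers_eqI[OF choosable] lower by blast+
qed

lemma thue_numbers_complete_bipartite:
  fixes G :: "('a, 'b) pre_digraph"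
  assumes "complete_bipartite_digraph m n G" "m \<ge> 1" "n \<ge> 1"
  shows "thue_chromatic_number G = min m n + 1" "thue_choice_number G = min m n + 1"
proof -
  obtain U V where G: "verts G = U \<union> V" "U \<inter> V = {}" "card U = m" "card V = n"
      "arcs_ends G = U \<times> V \<union> V \<times> U"
    using assms(1) unfolding complete_bipartite_digraph_def by blast
  have fin: "finite U" "finite V" and ne: "U \<noteq> {}" "V \<noteq> {}"
    using G(3,4) assms(2,3) by (auto intro: card_ge_0_finite)
  \<comment> \<open>Each side is a vertex cover; the smaller one gives the bound.\<close>
  have "thue_choosable G (card U + 1)" "thue_choosable G (card V + 1)"
    by (rule thue_choosable_vertex_cover; use G fin in auto)+
  then have choosable: "thue_choosable G (min m n + 1)"
    using G(3,4) by (simp add: min_def)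
  have lower: "min m n + 1 \<le> card (\<phi> ` verts G)"
    if \<phi>: "nonrepetitive G \<phi>" "finite (\<phi> ` verts G)" for \<phi> :: "'a \<Rightarrow> nat"
  proof -
    \<comment> \<open>All pairs across the sides are adjacent, so the sides share no colour.\<close>
    have disj: "\<phi> ` U \<inter> \<phi> ` V = {}"
    proof -
      have "\<phi> u \<noteq> \<phi> v" if "u \<in> U" "v \<in> V" for u v
        using nonrepetitive_arc_colours[OF \<phi>(1), of u v] that G by auto
      then show ?thesis by blast
    qed
    \<comment> \<open>Which side is injective is not known, but either has at least
      \<open>min m n\<close> vertices.\<close>
    have "inj_on \<phi> U \<or> inj_on \<phi> V"
      using nonrepetitive_bipartite_inj[OF \<phi>(1), of U V] G by simp
    then show ?thesis
    proof
      assume "inj_on \<phi> U"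
      then have "m + 1 \<le> card (\<phi> ` verts G)"
        using card_image_disjoint_ge[of \<phi> U V] \<phi>(2) disj ne G by simp
      then show ?thesis by simp
    next
      assume "inj_on \<phi> V"
      then have "n + 1 \<le> card (\<phi> ` verts G)"
        using card_image_disjoint_ge[of \<phi> V U] \<phi>(2) disj ne G by (simp add: Un_commute Int_commute)
      then show ?thesis by simp
    qed
  qed
  show "thue_chromatic_number G = min m n + 1" "thue_choice_number G = min m n + 1"
    using thue_numbers_eqI[OF choosable] lower by blast+
qed

theorem corollary2p3:
  fixes m n :: nat
  assumes "m \<ge> 1" and "n \<ge> 1"
  shows "(\<forall>G :: ('a, 'b) pre_digraph. complete_digraph n G \<longrightarrow>
            thue_chromatic_number G = n \<and> thue_choice_number G = n) \<and>
         (\<forall>G :: ('c, 'd) pre_digraph. star_graph n G \<longrightarrow>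
            thue_chromatic_number G = 2 \<and> thue_choice_number G = 2) \<and>
         (\<forall>G :: ('e, 'f) pre_digraph. complete_bipartite_digraph m n G \<longrightarrow>
            thue_chromatic_number G = min m n + 1 \<and> thue_choice_number G = min m n + 1)"
proof (intro conjI allI impI)
  fix G :: "('c, 'd) pre_digraph"
  assume "star_graph n G"
  then have "complete_bipartite_digraph 1 n G"
    by (simp add: star_graph_iff_complete_bipartite)
  moreover have "min 1 n + 1 = 2"
    using assms(2) by simp
  ultimately show "thue_chromatic_number G = 2" "thue_choice_number G = 2"
    using thue_numbers_complete_bipartite[of 1 n G] assms(2) by simp_all
qed (use assms in \<open>auto dest: thue_numbers_complete thue_numbers_complete_bipartite\<close>)

end
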